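(* Let $(X,d)$ be a complete metric space with $|X|\geq 3$ and let $T\colon X\to X$ be a large triangle-perimeter contraction. Suppose that $T$ has no periodic points of prime period $2$, and that there exist $x_0\in X$ and $L>0$ such that $d(x_0,T^n x_0)\leq L$ for all integers $n\geq 1$. Then $T$ has a fixed point in $X$, and the number of fixed points of $T$ is at most two.
   Context: For points $a,b,c$ of a metric space $(X,d)$, write $P(a,b,c):=d(a,b)+d(b,c)+d(a,c)$ (the perimeter of the triangle with vertices $a,b,c$). Let $(X,d)$ be a metric space with $|X|\geq 3$. A mapping $T\colon X\to X$ is called a large triangle-perimeter contraction if: (i) for all pairwise distinct points $x,y,z\in X$, $P(Tx,Ty,Tz)<P(x,y,z)$; (ii) for every $\varepsilon>0$ there exists a constant $\delta(\varepsilon)\in(0,1)$ such that for all pairwise distinct points $x,y,z\in X$ with $\max\{d(x,y),d(y,z),d(x,z)\}\geq\varepsilon$ one has $P(Tx,Ty,Tz)\leq\delta(\varepsilon)\,P(x,y,z)$. A point $x\in X$ is a periodic point of prime period $2$ of $T$ if $T^2x=x$ and $Tx\neq x$. Here $T^n$ denotes the $n$-fold iterate of $T$. *)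

theory Defs
  imports "HOL-Analysis.Analysis"
begin

definition perimeter :: "('a \<Rightarrow> 'a \<Rightarrow> real) \<Rightarrow> 'a \<Rightarrow> 'a \<Rightarrow> 'a \<Rightarrow> real" where
  "perimeter d a b c = d a b + d b c + d a c"

text \<open>The metric space is a carrier \<open>X\<close> with a distance \<open>d\<close>. The library's \<open>Metric_space\<close>
  asks for nonnegativity and symmetry of \<open>d\<close> on the whole type; this is no restriction, as a
  metric on \<open>X\<close> extends by \<open>0\<close>. Values of \<open>T\<close> outside \<open>X\<close> are irrelevant. Since \<open>card\<close> is
  \<open>0\<close> on infinite sets, \<open>|X| \<ge> 3\<close> is stated conditionally on finiteness.\<close>

definition large_triangle_perimeter_contraction ::
    "'a set \<Rightarrow> ('a \<Rightarrow> 'a \<Rightarrow> real) \<Rightarrow> ('a \<Rightarrow> 'a) \<Rightarrow> bool" where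
  "large_triangle_perimeter_contraction X d T \<longleftrightarrow>
     Metric_space X d \<and> (finite X \<longrightarrow> 3 \<le> card X) \<and> T \<in> X \<rightarrow> X \<and>
     (\<forall>x\<in>X. \<forall>y\<in>X. \<forall>z\<in>X. x \<noteq> y \<and> y \<noteq> z \<and> x \<noteq> z \<longrightarrow>
        perimeter d (T x) (T y) (T z) < perimeter d x y z) \<and>
     (\<forall>\<epsilon>>0. \<exists>\<delta>. 0 < \<delta> \<and> \<delta> < 1 \<and>
        (\<forall>x\<in>X. \<forall>y\<in>X. \<forall>z\<in>X. x \<noteq> y \<and> y \<noteq> z \<and> x \<noteq> z \<and>
           Max {d x y, d y z, d x z} \<ge> \<epsilon> \<longrightarrow>
           perimeter d (T x) (T y) (T z) \<le> \<delta> * perimeter d x y z))"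

definition periodic_point_prime_period_2 :: "('a \<Rightarrow> 'a) \<Rightarrow> 'a \<Rightarrow> bool" where
  "periodic_point_prime_period_2 T x \<longleftrightarrow> (T ^^ 2) x = x \<and> T x \<noteq> x"

end

theory Submission
  imports Defs
begin

text \<open>If \<open>T\<close> has no fixed point, three consecutive points of an orbit are pairwise distinct, and
  their perimeter decreases strictly along the orbit; hence all points of the orbit are distinct.
  Then (ii) applies to every triple of orbit points, with one constant for all triples of perimeter
  at least \<open>\<epsilon>\<close>. For a bounded orbit, the perimeter of a triple therefore drops below \<open>\<epsilon>\<close> after a
  number of steps that does not depend on the triple, so the orbit is Cauchy. Comparing the triples
  \<open>(x\<^sup>*, x\<^sub>n, x\<^sub>n\<^sub>+\<^sub>1)\<close> and their images shows that its limit \<open>x\<^sup>*\<close> is a fixed point after all.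
  Three fixed points would contradict (i).\<close>

lemma large_triangle_perimeter_contractionD:
  assumes "large_triangle_perimeter_contraction X d T"
  shows "Metric_space X d" "T \<in> X \<rightarrow> X"
    and "\<lbrakk>x \<in> X; y \<in> X; z \<in> X; x \<noteq> y; y \<noteq> z; x \<noteq> z\<rbrakk>
      \<Longrightarrow> perimeter d (T x) (T y) (T z) < perimeter d x y z"
  using assms by (auto simp: large_triangle_perimeter_contraction_def)

text \<open>If a perimeter is at least \<epsilon>, some side is at least \<epsilon>/3, so the
  constant of (ii) for \<epsilon>/3 serves. This form can be iterated along triples of
  iterates.\<close>

lemma large_triangle_perimeter_contraction_factor:
  assumes "large_triangle_perimeter_contraction X d T" and "\<epsilon> > 0"
  obtains c where "0 < c" "c < 1"
    "\<And>x y z. \<lbrakk>x \<in> X; y \<in> X; z \<in> X; x \<noteq> y; y \<noteq> z; x \<noteq> z; perimeter d x y z \<ge> \<epsilon>\<rbrakk>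
      \<Longrightarrow> perimeter d (T x) (T y) (T z) \<le> c * perimeter d x y z"
proof -
  have "\<epsilon> / 3 > 0"
    using assms(2) by simp
  then obtain c where c: "0 < c" "c < 1"
    and contr: "\<forall>x\<in>X. \<forall>y\<in>X. \<forall>z\<in>X. x \<noteq> y \<and> y \<noteq> z \<and> x \<noteq> z \<and> Max {d x y, d y z, d x z} \<ge> \<epsilon> / 3 \<longrightarrow>
      perimeter d (T x) (T y) (T z) \<le> c * perimeter d x y z"
    using assms(1) unfolding large_triangle_perimeter_contraction_def by meson
  show thesis
  proof (rule that[OF c])
    fix x y z
    assume xyz: "x \<in> X" "y \<in> X" "z \<in> X" "x \<noteq> y" "y \<noteq> z" "x \<noteq> z"
      and "perimeter d x y z \<ge> \<epsilon>"
    then have "Max {d x y, d y z, d x z} \<ge> \<epsilon> / 3"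
      unfolding perimeter_def by (auto simp: le_max_iff_disj)
    with xyz contr show "perimeter d (T x) (T y) (T z) \<le> c * perimeter d x y z"
      by blast
  qed
qed

lemma funpow_in_carrier:
  assumes "T \<in> X \<rightarrow> X" "x \<in> X"
  shows "(T ^^ n) x \<in> X"
  using assms by (induction n) auto

lemma inj_orbit:
  assumes contr: "large_triangle_perimeter_contraction X d T" and x: "x \<in> X"
    and nofix: "\<And>y. y \<in> X \<Longrightarrow> T y \<noteq> y"
    and noper: "\<And>y. y \<in> X \<Longrightarrow> T (T y) \<noteq> y"
  shows "inj (\<lambda>n. (T ^^ n) x)"
proof -
  note D = large_triangle_perimeter_contractionD[OF contr]
  let ?p = "\<lambda>n. perimeter d ((T ^^ n) x) (T ((T ^^ n) x)) (T (T ((T ^^ n) x)))"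
  have dec_Suc: "?p (Suc n) < ?p n" for n
  proof -
    define y where "y = (T ^^ n) x"
    have y: "y \<in> X"
      unfolding y_def using D(2) x by (rule funpow_in_carrier)
    have Ty: "T y \<in> X" "T (T y) \<in> X"
      using y D(2) by auto
    have "perimeter d (T y) (T (T y)) (T (T (T y))) < perimeter d y (T y) (T (T y))"
      using D(3)[OF y Ty] nofix[OF y] nofix[OF Ty(1)] noper[OF y] by metis
    then show ?thesis
      by (simp add: y_def)
  qed
  have dec: "?p n < ?p m" if "m < n" for m n
    using that
  proof (induction rule: less_Suc_induct)
    case (1 i)
    show ?case
      by (rule dec_Suc)
  next
    case (2 i j k)
    then show ?case
      by linarith
  qed
  show ?thesis
  proof (rule linorder_injI)
    fix m n :: nat
    assume "m < n"
    \<comment> \<open>The triple behind \<open>?p n\<close> is determined by its first point, so a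
      repeated orbit point would force \<open>?p m = ?p n\<close>.\<close>
    then show "(T ^^ m) x \<noteq> (T ^^ n) x"
      using dec[of m n] by auto
  qed
qed

lemma MCauchy_orbit:
  assumes contr: "large_triangle_perimeter_contraction X d T" and x: "x \<in> X"
    and inj: "inj (\<lambda>n. (T ^^ n) x)"
    and bdd: "\<And>n. d x ((T ^^ n) x) \<le> L"
  shows "Metric_space.MCauchy X d (\<lambda>n. (T ^^ n) x)"
proof -
  note D = large_triangle_perimeter_contractionD[OF contr]
  interpret Metric_space X d
    by (fact D(1))
  define s where "s = (\<lambda>n. (T ^^ n) x)"
  have s_in: "s n \<in> X" for n
    unfolding s_def using D(2) x by (rule funpow_in_carrier)
  have s_Suc: "s (Suc n) = T (s n)" for n
    by (simp add: s_def)
  have s_eq: "s m = s n \<longleftrightarrow> m = n" for m n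
    using inj by (auto simp: s_def dest: injD)
  have le_2L: "d (s m) (s n) \<le> 2 * L" for m n
    using triangle[OF s_in[of m] x s_in[of n]] bdd[of m] bdd[of n] commute[of x "s m"]
    by (simp add: s_def)
  \<comment> \<open>Any two orbit points are within \<open>2 * L\<close> of each other via
    \<open>x\<close>, and a perimeter has three sides.\<close>
  have bound: "perimeter d (s i) (s j) (s k) \<le> 6 * L" for i j k
    using le_2L[of i j] le_2L[of j k] le_2L[of i k] by (simp add: perimeter_def)
  have "\<exists>N. \<forall>m n. N \<le> m \<longrightarrow> N \<le> n \<longrightarrow> d (s m) (s n) < \<epsilon>" if eps: "\<epsilon> > 0" for \<epsilon>
  proof -
    obtain c where c: "0 < c" "c < 1" and le:
      "\<And>x y z. \<lbrakk>x \<in> X; y \<in> X; z \<in> X; x \<noteq> y; y \<noteq> z; x \<noteq> z; perimeter d x y z \<ge> \<epsilon>\<rbrakk>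
        \<Longrightarrow> perimeter d (T x) (T y) (T z) \<le> c * perimeter d x y z"
      using large_triangle_perimeter_contraction_factor[OF contr eps] by blast
    \<comment> \<open>Once below \<epsilon>, a perimeter stays there by (i); until then each step
      contributes a factor \<open>c\<close>. Injectivity keeps the shifted triples pairwise
      distinct.\<close>
    have decay: "perimeter d (s (i + r)) (s (j + r)) (s (k + r)) < \<epsilon> \<or>
        perimeter d (s (i + r)) (s (j + r)) (s (k + r)) \<le> c ^ r * (6 * L)"
      if "i \<noteq> j" "j \<noteq> k" "i \<noteq> k" for i j k r
    proof (induction r)
      case 0
      then show ?case
        using bound by simp
    next
      case (Suc r)
      let ?p = "perimeter d (s (i + r)) (s (j + r)) (s (k + r))"
      let ?q = "perimeter d (s (i + Suc r)) (s (j + Suc r)) (s (k + Suc r))"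
      show ?case
      proof (cases "?p < \<epsilon>")
        case True
        have "?q < ?p"
          using that by (simp add: s_Suc) (intro D(3) s_in; simp add: s_eq)
        with True show ?thesis
          by simp
      next
        case False
        have "?q \<le> c * ?p"
          using that False by (simp add: s_Suc) (intro le s_in; simp add: s_eq)
        also have "\<dots> \<le> c * (c ^ r * (6 * L))"
          using False Suc.IH c by (intro mult_left_mono) auto
        finally show ?thesis
          by (simp add: mult.assoc)
      qed
    qed
    have "(\<lambda>r. c ^ r * (6 * L)) \<longlonglongrightarrow> 0 * (6 * L)"
      using c by (intro tendsto_mult_right LIMSEQ_realpow_zero) auto
    then have "\<forall>\<^sub>F r in sequentially. c ^ r * (6 * L) < \<epsilon>"
      using eps by (intro order_tendstoD(2)) auto
    \<comment> \<open>The bound does not mention the indices of the triple, so one \<open>N\<close>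
      serves all triples.\<close>
    then obtain N where N: "c ^ N * (6 * L) < \<epsilon>"
      by (auto simp: eventually_sequentially)
    have "d (s m) (s n) < \<epsilon>" if "N \<le> m" "N \<le> n" for m n
    proof (cases "m = n")
      case True
      then show ?thesis
        using eps s_in by simp
    next
      case False
      \<comment> \<open>A third index, different from both \<open>m\<close> and \<open>n\<close>,
        completes the pair to a triple whose perimeter dominates
        \<open>d (s m) (s n)\<close>.\<close>
      define k where "k = Suc (m + n)"
      have "perimeter d (s (m - N + N)) (s (n - N + N)) (s (k - N + N)) < \<epsilon>"
        using decay[of "m - N" "n - N" "k - N" N] N False that by (force simp: k_def)
      then have "perimeter d (s m) (s n) (s k) < \<epsilon>"
        using that by (simp add: k_def)
      then show ?thesis
        using nonneg[of "s n" "s k"] nonneg[of "s m" "s k"] unfolding perimeter_def by linarith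
    qed
    then show ?thesis
      by blast
  qed
  then have "MCauchy s"
    using s_in by (auto simp: MCauchy_def)
  then show ?thesis
    by (simp add: s_def)
qed

text \<open>Condition (i) takes the place of continuity of \<open>T\<close> at \<open>y\<close>: it
  bounds the distance from \<open>T y\<close> to the orbit by perimeters that tend to 0.\<close>

lemma fixed_point_of_orbit_limit:
  assumes contr: "large_triangle_perimeter_contraction X d T" and x: "x \<in> X"
    and inj: "inj (\<lambda>n. (T ^^ n) x)"
    and lim: "limitin (Metric_space.mtopology X d) (\<lambda>n. (T ^^ n) x) y sequentially"
  shows "y \<in> X" "T y = y"
proof -
  note D = large_triangle_perimeter_contractionD[OF contr]
  interpret Metric_space X d
    by (fact D(1))
  define s where "s = (\<lambda>n. (T ^^ n) x)"
  have s_in: "s n \<in> X" for n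
    unfolding s_def using D(2) x by (rule funpow_in_carrier)
  have s_Suc: "s (Suc n) = T (s n)" for n
    by (simp add: s_def)
  have s_eq: "s m = s n \<longleftrightarrow> m = n" for m n
    using inj by (auto simp: s_def dest: injD)
  show y: "y \<in> X"
    using lim limitin_mspace by blast
  then have Ty: "T y \<in> X"
    using D(2) by auto
  have d0: "(\<lambda>n. d (s n) y) \<longlonglongrightarrow> 0"
    using lim unfolding limitin_metric_dist_null s_def by blast
  then have d1: "(\<lambda>n. d (s (Suc n)) y) \<longlonglongrightarrow> 0"
    by (rule LIMSEQ_Suc)
  \<comment> \<open>An injective orbit meets its limit at most once; after that, \<open>y\<close>,
    \<open>s n\<close> and \<open>s (Suc n)\<close> are pairwise distinct.\<close>
  have "\<exists>N. \<forall>n\<ge>N. s n \<noteq> y"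
  proof (cases "\<exists>m. s m = y")
    case True
    then obtain m where "s m = y"
      by blast
    then have "\<forall>n\<ge>Suc m. s n \<noteq> y"
      using s_eq by fastforce
    then show ?thesis
      by blast
  qed simp
  then obtain N where N: "s n \<noteq> y" if "n \<ge> N" for n
    by blast
  \<comment> \<open>With a = \<open>d (s n) y\<close> and b = \<open>d (s (Suc n)) y\<close>, the
    perimeter of \<open>y\<close>, \<open>s n\<close>, \<open>s (Suc n)\<close> is at most 2a + 2b;
    going from \<open>s (Suc n)\<close> to \<open>y\<close> adds another b.\<close>
  have "d (T y) y \<le> 3 * (d (s n) y + d (s (Suc n)) y)" if "n \<ge> N" for n
  proof -
    have "perimeter d (T y) (s (Suc n)) (s (Suc (Suc n))) < perimeter d y (s n) (s (Suc n))"
      using N[of n] N[of "Suc n"] that s_eq[of n "Suc n"]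
      by (subst (1 2) s_Suc) (intro D(3) y s_in, auto)
    then have "d (T y) (s (Suc n)) < d y (s n) + d (s n) (s (Suc n)) + d y (s (Suc n))"
      using nonneg[of "s (Suc n)" "s (Suc (Suc n))"] nonneg[of "T y" "s (Suc (Suc n))"]
      unfolding perimeter_def by linarith
    moreover have "d (s n) (s (Suc n)) \<le> d (s n) y + d y (s (Suc n))"
      by (intro triangle s_in y)
    moreover have "d (T y) y \<le> d (T y) (s (Suc n)) + d (s (Suc n)) y"
      by (intro triangle s_in y Ty)
    ultimately show ?thesis
      using commute[of y "s n"] commute[of y "s (Suc n)"] nonneg[of "s n" y] by argo
  qed
  then have "\<forall>\<^sub>F n in sequentially. d (T y) y \<le> 3 * (d (s n) y + d (s (Suc n)) y)"
    unfolding eventually_sequentially by blast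
  moreover have "(\<lambda>n. 3 * (d (s n) y + d (s (Suc n)) y)) \<longlonglongrightarrow> 3 * (0 + 0)"
    by (intro tendsto_intros d0 d1)
  ultimately have "d (T y) y \<le> 3 * (0 + 0)"
    by (intro tendsto_lowerbound) auto
  then show "T y = y"
    using nonneg[of "T y" y] zero[OF Ty y] by simp
qed

lemma card_fixed_points_le_2:
  assumes "large_triangle_perimeter_contraction X d T"
  shows "finite {x \<in> X. T x = x} \<and> card {x \<in> X. T x = x} \<le> 2"
proof (rule ccontr)
  let ?F = "{x \<in> X. T x = x}"
  assume "\<not> (finite ?F \<and> card ?F \<le> 2)"
  \<comment> \<open>This form covers infinite \<open>?F\<close> too, where \<open>card\<close> is 0;
    either way there is a subset of three points.\<close>
  then have "finite ?F \<longrightarrow> 3 \<le> card ?F"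
    by auto
  then obtain A where "A \<subseteq> ?F" "card A = 3"
    using infinite_arbitrarily_large[of ?F 3] obtain_subset_with_card_n[of 3 ?F] by blast
  then obtain x y z where "x \<in> ?F" "y \<in> ?F" "z \<in> ?F" "x \<noteq> y" "y \<noteq> z" "x \<noteq> z"
    by (auto simp: card_3_iff)
  then show False
    using large_triangle_perimeter_contractionD(3)[OF assms, of x y z] by auto
qed

theorem theorem3p1:
  fixes X :: "'a set" and d :: "'a \<Rightarrow> 'a \<Rightarrow> real" and T :: "'a \<Rightarrow> 'a"
  assumes "Metric_space X d"
    and "Metric_space.mcomplete X d"
    and "finite X \<longrightarrow> 3 \<le> card X"
    and "large_triangle_perimeter_contraction X d T"
    and "\<not> (\<exists>x\<in>X. periodic_point_prime_period_2 T x)"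
    and "\<exists>x0\<in>X. \<exists>L>0. \<forall>n\<ge>1. d x0 ((T ^^ n) x0) \<le> L"
  shows "(\<exists>x\<in>X. T x = x) \<and> finite {x \<in> X. T x = x} \<and> card {x \<in> X. T x = x} \<le> 2"
proof -
  interpret Metric_space X d
    by (fact assms(1))
  obtain x L where x: "x \<in> X" "L > 0" and L: "\<forall>n\<ge>1. d x ((T ^^ n) x) \<le> L"
    using assms(6) by blast
  \<comment> \<open>For \<open>n = 0\<close> the distance is 0, and \<open>L > 0\<close>.\<close>
  have bdd: "d x ((T ^^ n) x) \<le> L" for n
    using L x by (cases n) auto
  have "\<exists>y\<in>X. T y = y"
  proof (rule ccontr)
    assume nofix: "\<not> (\<exists>y\<in>X. T y = y)"
    \<comment> \<open>Without fixed points, every solution of \<open>T (T y) = y\<close> has prime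
      period 2.\<close>
    then have "T (T y) \<noteq> y" if "y \<in> X" for y
      using assms(5) that by (auto simp: periodic_point_prime_period_2_def numeral_2_eq_2)
    with nofix have inj: "inj (\<lambda>n. (T ^^ n) x)"
      using inj_orbit[OF assms(4) x(1)] by blast
    have "MCauchy (\<lambda>n. (T ^^ n) x)"
      by (rule MCauchy_orbit[OF assms(4) x(1) inj bdd])
    then obtain y where "limitin mtopology (\<lambda>n. (T ^^ n) x) y sequentially"
      using assms(2) unfolding mcomplete_def by blast
    then show False
      using fixed_point_of_orbit_limit[OF assms(4) x(1) inj] nofix by blast
  qed
  then show ?thesis
    using card_fixed_points_le_2[OF assms(4)] by blast
qed

end
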